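(* Let $d\ge 2$ be an integer. (a) Let $D\ge 1$ be an integer, let $\alpha_j^{(i)}\ge 0$ ($i=1,\dots,d$, $j=1,\dots,D$) be constants, let $C>0$ satisfy $C\ge \max_{1\le i\le d}\sum_{j=1}^D\alpha_j^{(i)}$, and let ${\bf X}=(X_1,\dots,X_d)$ be the max-mixture vector with parameters $(D,(\alpha_j^{(i)}),C)$. Then ${\bf X}$ has tail dependence coefficients $$\lambda_{sk}=\frac1C\sum_{j=1}^{D}\min\left(\alpha_j^{(s)},\alpha_j^{(k)}\right),\qquad s,k\in\{1,\dots,d\},\ s\ne k.$$ (b) Let $\{\lambda_{sk}: s,k\in\{1,\dots,d\},\ s\neq k\}$ be the (symmetric, i.e. $\lambda_{sk}=\lambda_{ks}$) family of tail dependence coefficients of some $d$-dimensional random vector, and let $C\ge d-1$ be a constant. Then there exist an integer $D\ge1$ and constants $\alpha_j^{(i)}\ge 0$ ($i=1,\dots,d$, $j=1,\dots,D$) with $\max_{1\le i\le d}\sum_{j=1}^D\alpha_j^{(i)}\le C$ such that the max-mixture vector ${\bf X}$ with parameters $(D,(\alpha_j^{(i)}),C)$ has as tail dependence coefficients $\left\{\frac1C\lambda_{sk}: s,k\in\{1,\dots,d\},\ s\neq k\right\}$, i.e. for all $s\ne k$ the tail dependence coefficient between $X_s$ and $X_k$ equals $\frac1C\lambda_{sk}$.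
   Context: A unit Fréchet random variable $Z$ has distribution function $P(Z\le x)=e^{-1/x}$ for $x>0$ and $0$ for $x\le 0$. Max-mixture vector: given integers $d\ge2$, $D\ge 1$, constants $\alpha_j^{(i)}\ge 0$ ($i=1,\dots,d$, $j=1,\dots,D$) and $C>0$ with $C\ge \max_{1\le i\le d}\sum_{j=1}^D\alpha_j^{(i)}$, the max-mixture vector with parameters $(D,(\alpha_j^{(i)}),C)$ is ${\bf X}=(X_1,\dots,X_d)$ with $$X_i=\max\left\{\max_{1\le j\le D}\alpha_j^{(i)}Z_j,\ \Big(C-\sum_{j=1}^{D}\alpha_j^{(i)}\Big)Y_i\right\},\qquad i=1,\dots,d,$$ where $Y_1,\dots,Y_d,Z_1,\dots,Z_D$ are independent unit Fréchet random variables. Tail dependence coefficient: for a random vector $(W_1,\dots,W_d)$ with marginal distribution functions $F_{W_i}$, the tail dependence coefficient between $W_s$ and $W_k$ is $$\lambda_{sk}=\lim_{u\uparrow 1}P\big(F_{W_s}(W_s)>u\mid F_{W_k}(W_k)>u\big),$$ assumed to exist when one speaks of the tail dependence coefficients of the vector. *)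

theory Defs
  imports "HOL-Probability.Probability"
begin

definition unit_frechet :: "'a measure \<Rightarrow> ('a \<Rightarrow> real) \<Rightarrow> bool" where
  "unit_frechet M Z \<longleftrightarrow>
     Z \<in> borel_measurable M \<and>
     (\<forall>x. cdf (distr M borel Z) x = (if 0 < x then exp (- 1 / x) else 0))"

text \<open>
  Vectors are indexed by \<open>{1..d}\<close>, and \<open>\<alpha> i j\<close> stands for $\alpha_j^{(i)}$.
  The predicate says that \<open>X\<close>, defined on the probability space \<open>M\<close>, is a realisation of the
  max-mixture vector. Joint independence of all the \<open>Y\<^sub>i\<close> and \<open>Z\<^sub>j\<close> is independence of one family
  indexed by a disjoint sum. The constraints on the parameters \<open>D\<close>, \<open>\<alpha>\<close>, \<open>C\<close> are not part of it.
\<close>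

definition max_mixture_vector ::
    "'a measure \<Rightarrow> nat \<Rightarrow> nat \<Rightarrow> (nat \<Rightarrow> nat \<Rightarrow> real) \<Rightarrow> real \<Rightarrow> (nat \<Rightarrow> 'a \<Rightarrow> real) \<Rightarrow> bool" where
  "max_mixture_vector M d D \<alpha> C X \<longleftrightarrow>
     prob_space M \<and>
     (\<exists>Y Z.
        (\<forall>i\<in>{1..d}. unit_frechet M (Y i)) \<and>
        (\<forall>j\<in>{1..D}. unit_frechet M (Z j)) \<and>
        prob_space.indep_vars M (\<lambda>_. borel) (case_sum Y Z) ({1..d} <+> {1..D}) \<and>
        (\<forall>i\<in>{1..d}. \<forall>\<omega>\<in>space M.
           X i \<omega> = max (MAX j\<in>{1..D}. \<alpha> i j * Z j \<omega>) ((C - (\<Sum>j=1..D. \<alpha> i j)) * Y i \<omega>)))"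

text \<open>
  The limit exists and equals \<open>l\<close>. The conditioning event has probability at least \<open>1 - u\<close> for
  every \<open>u < 1\<close>, whatever the distribution of \<open>W k\<close>, so \<^const>\<open>cond_prob\<close> never divides by zero.
\<close>

definition has_tail_dependence_coeff ::
    "'a measure \<Rightarrow> (nat \<Rightarrow> 'a \<Rightarrow> real) \<Rightarrow> nat \<Rightarrow> nat \<Rightarrow> real \<Rightarrow> bool" where
  "has_tail_dependence_coeff M W s k l \<longleftrightarrow>
     ((\<lambda>u. cond_prob M
             (\<lambda>\<omega>. cdf (distr M borel (W s)) (W s \<omega>) > u)
             (\<lambda>\<omega>. cdf (distr M borel (W k)) (W k \<omega>) > u)) \<longlongrightarrow> l) (at_left 1)"

end

theory Submission
  imports Defs "HOL-Real_Asymp.Real_Asymp"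
begin

text \<open>
  For $x > 0$ the event $X_i \le x$ is an intersection of events $b_n V_n \le x$ over the independent
  unit Frechet variables $V_n$, so its probability is $\exp(-\sum_n b_n / x) = \exp(-C/x)$. For two
  components the weights combine by maxima, and
  $\sum_n \max(b_n, b'_n) = 2C - \sum_j \min(\alpha_j^{(s)}, \alpha_j^{(k)}) = (2 - \lambda) C$. At the
  common marginal $u$-quantile the joint exceedance probability is therefore
  $1 - 2u + u^{2-\lambda}$, and dividing by $1 - u$ and letting $u \uparrow 1$ gives $\lambda$.

  For the converse, use one variable $Z_j$ for each pair $s < k$, with weight $\lambda_{sk}$ in the
  components $s$ and $k$ and weight $0$ elsewhere. Each row then sums to at most $d - 1$, because a
  tail dependence coefficient is at most $1$.
\<close>

section \<open>Weighted independent Frechet variables\<close>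

lemma unit_frechet_prob_le:
  assumes "unit_frechet M Z" "0 < x"
  shows "measure M (Z -` {..x} \<inter> space M) = exp (- 1 / x)"
proof -
  have [measurable]: "Z \<in> borel_measurable M" using assms by (simp add: unit_frechet_def)
  have "measure M (Z -` {..x} \<inter> space M) = cdf (distr M borel Z) x"
    by (simp add: cdf_def2 measure_distr)
  then show ?thesis using assms by (simp add: unit_frechet_def)
qed

lemma unit_frechet_prob_scaled_le:
  assumes "prob_space M" "unit_frechet M Z" "0 \<le> c" "0 < x"
  shows "measure M (Z -` {z. c * z \<le> x} \<inter> space M) = exp (- c / x)"
proof (cases "c = 0")
  \<comment> \<open>With weight zero the event is the whole space, as \<open>0 < x\<close>, and the
    formula reads \<open>exp 0 = 1\<close>. Zero weights can therefore stay in the sums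
    below.\<close>
  case True
  then show ?thesis using assms by (simp add: prob_space.prob_space)
next
  case False
  then have "{z. c * z \<le> x} = {..x / c}"
    using assms by (auto simp: field_simps)
  then show ?thesis
    using unit_frechet_prob_le[OF assms(2), of "x / c"] assms False by simp
qed

text \<open>Max-stability of the Frechet family: independence factors the event, and multiplying the
  factors adds the weights in the exponent.\<close>

lemma (in prob_space) indep_unit_frechet_prob_scaled_le:
  assumes "indep_vars (\<lambda>_. borel) V I" "finite I" "I \<noteq> {}"
    and "\<And>i. i \<in> I \<Longrightarrow> unit_frechet M (V i)" "\<And>i. i \<in> I \<Longrightarrow> 0 \<le> c i" "0 < x"
  shows "\<P>(\<omega> in M. \<forall>i\<in>I. c i * V i \<omega> \<le> x) = exp (- (\<Sum>i\<in>I. c i) / x)"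
proof -
  have "{\<omega> \<in> space M. \<forall>i\<in>I. c i * V i \<omega> \<le> x} = (\<Inter>i\<in>I. V i -` {z. c i * z \<le> x} \<inter> space M)"
    using assms(3) by auto
  then have "\<P>(\<omega> in M. \<forall>i\<in>I. c i * V i \<omega> \<le> x)
      = (\<Prod>i\<in>I. prob (V i -` {z. c i * z \<le> x} \<inter> space M))"
    using indep_varsD_finite[OF assms(1,3,2), of "\<lambda>i. {z. c i * z \<le> x}"] by simp
  also have "\<dots> = (\<Prod>i\<in>I. exp (- c i / x))"
    using unit_frechet_prob_scaled_le[OF prob_space_axioms] assms by simp
  also have "\<dots> = exp (- (\<Sum>i\<in>I. c i) / x)"
    using assms(2) by (simp add: exp_sum[symmetric] sum_divide_distrib sum_negf)
  finally show ?thesis .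
qed

section \<open>Tail dependence under a common Frechet marginal\<close>

text \<open>The threshold is the \<open>u\<close>-quantile of the law \<open>exp (- C / x)\<close>.
  It depends only on \<open>C\<close> and \<open>u\<close>, so two components with the same marginal
  are compared with one and the same threshold.\<close>

lemma (in prob_space) cdf_greater_iff_frechet:
  assumes [measurable]: "X \<in> borel_measurable M" and "0 < C"
    and X: "\<And>x. 0 < x \<Longrightarrow> \<P>(\<omega> in M. X \<omega> \<le> x) = exp (- C / x)"
    and "0 < u" "u < 1"
  shows "u < cdf (distr M borel X) x \<longleftrightarrow> - (C / ln u) < x"
proof -
  interpret D: real_distribution "distr M borel X"
    by (rule real_distribution_distr) simp
  define q where "q = - (C / ln u)"
  have "ln u < 0" using assms by simp
  then have q: "0 < q" "exp (- C / q) = u"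
    using assms by (auto simp: q_def divide_pos_neg)
  have F: "cdf (distr M borel X) y = exp (- C / y)" if "0 < y" for y
  proof -
    have "X -` {..y} \<inter> space M = {\<omega> \<in> space M. X \<omega> \<le> y}" by auto
    then show ?thesis using X[OF that] by (simp add: cdf_def2 measure_distr)
  qed
  show ?thesis
  proof (cases "x \<le> q")
    \<comment> \<open>Here \<open>x\<close> may be nonpositive, where no formula for the cdf is
      assumed; monotonicity up to \<open>q\<close> covers that as well.\<close>
    case True
    then show ?thesis using D.cdf_nondecreasing[OF True] F[OF q(1)] q by (simp add: q_def[symmetric])
  next
    case False
    then have "- C / q < - C / x" using q assms by (simp add: field_simps)
    then have "u < exp (- C / x)" using q(2) by (metis exp_less_cancel_iff)
    then show ?thesis using False F[of x] q by (simp add: q_def[symmetric])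
  qed
qed

lemma (in prob_space) prob_both_greater:
  fixes X Y :: "'a \<Rightarrow> real"
  assumes [measurable]: "X \<in> borel_measurable M" "Y \<in> borel_measurable M"
  shows "\<P>(\<omega> in M. x < X \<omega> \<and> x < Y \<omega>)
    = 1 - \<P>(\<omega> in M. X \<omega> \<le> x) - \<P>(\<omega> in M. Y \<omega> \<le> x) + \<P>(\<omega> in M. X \<omega> \<le> x \<and> Y \<omega> \<le> x)"
proof -
  let ?A = "{\<omega> \<in> space M. X \<omega> \<le> x}" and ?B = "{\<omega> \<in> space M. Y \<omega> \<le> x}"
  have "{\<omega> \<in> space M. x < X \<omega> \<and> x < Y \<omega>} = space M - (?A \<union> ?B)" by auto
  moreover have "{\<omega> \<in> space M. X \<omega> \<le> x \<and> Y \<omega> \<le> x} = ?A \<inter> ?B" by auto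
  moreover have "prob (?A \<union> ?B) = prob ?A + prob ?B - prob (?A \<inter> ?B)"
    by (rule measure_Un3) (auto simp: fmeasurable_eq_sets)
  ultimately show ?thesis by (simp add: prob_compl)
qed

text \<open>At the common quantile \<open>q\<close> the joint law \<open>exp (- E / q)\<close>
  becomes \<open>u powr (E / C)\<close>. The conditional probability is then an elementary function
  of \<open>u\<close>, and its limit is a derivative at 1.\<close>

lemma (in prob_space) has_tail_dependence_coeff_frechet:
  assumes [measurable]: "X s \<in> borel_measurable M" "X k \<in> borel_measurable M" and "0 < C"
    and s: "\<And>x. 0 < x \<Longrightarrow> \<P>(\<omega> in M. X s \<omega> \<le> x) = exp (- C / x)"
    and k: "\<And>x. 0 < x \<Longrightarrow> \<P>(\<omega> in M. X k \<omega> \<le> x) = exp (- C / x)"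
    and sk: "\<And>x. 0 < x \<Longrightarrow> \<P>(\<omega> in M. X s \<omega> \<le> x \<and> X k \<omega> \<le> x) = exp (- E / x)"
  shows "has_tail_dependence_coeff M X s k (2 - E / C)"
proof -
  define p where "p = E / C"
  have ev: "(1 - 2 * u + u powr p) / (1 - u) =
      cond_prob M (\<lambda>\<omega>. cdf (distr M borel (X s)) (X s \<omega>) > u) (\<lambda>\<omega>. cdf (distr M borel (X k)) (X k \<omega>) > u)"
    if u: "0 < u" "u < 1" for u
  proof -
    define q where "q = - (C / ln u)"
    have "ln u < 0" using u by simp
    then have q: "0 < q" "exp (- C / q) = u"
      using \<open>0 < C\<close> u by (auto simp: q_def divide_pos_neg)
    have "- E / q = p * ln u" using \<open>0 < C\<close> by (simp add: q_def p_def)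
    then have E: "exp (- E / q) = u powr p" using u by (simp add: powr_def)
    \<comment> \<open>Inclusion-exclusion for \<open>X k\<close> paired with itself is just the
      complement rule.\<close>
    have "\<P>(\<omega> in M. q < X k \<omega>) = 1 - u"
      using prob_both_greater[of "X k" "X k" q] k[OF q(1)] q(2) by simp
    moreover have "\<P>(\<omega> in M. q < X s \<omega> \<and> q < X k \<omega>) = 1 - 2 * u + u powr p"
      using prob_both_greater[of "X s" "X k" q] s[OF q(1)] k[OF q(1)] sk[OF q(1)] q(2) E by simp
    ultimately show ?thesis
      by (simp add: cond_prob_def cdf_greater_iff_frechet[OF _ \<open>0 < C\<close> s u]
          cdf_greater_iff_frechet[OF _ \<open>0 < C\<close> k u] q_def[symmetric])
  qed
  have "((\<lambda>u. (1 - 2 * u + u powr p) / (1 - u)) \<longlongrightarrow> 2 - p) (at_left 1)"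
  proof -
    \<comment> \<open>The numerator vanishes at 1, so dividing it by \<open>u - 1\<close> gives
      exactly its difference quotient there; the denominator \<open>1 - u\<close> only flips the
      sign.\<close>
    have "((\<lambda>u. 1 - 2 * u + u powr p) has_real_derivative p - 2) (at 1)"
      by (auto intro!: derivative_eq_intros)
    then have "((\<lambda>u. (1 - 2 * u + u powr p) / (u - 1)) \<longlongrightarrow> p - 2) (at_left 1)"
      unfolding has_field_derivative_iff
      by (auto intro: filterlim_mono[OF _ order_refl at_le])
    then have "((\<lambda>u. - ((1 - 2 * u + u powr p) / (u - 1))) \<longlongrightarrow> - (p - 2)) (at_left 1)"
      by (rule tendsto_minus)
    then show ?thesis by (simp add: minus_divide_right)
  qed
  moreover have "\<forall>\<^sub>F u in at_left (1::real). 0 < u \<and> u < 1"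
    using eventually_at_left_real[of 0 "1::real"] by simp
  ultimately show ?thesis
    unfolding has_tail_dependence_coeff_def p_def[symmetric]
    by (elim Lim_transform_eventually eventually_mono) (simp add: ev)
qed

section \<open>Tail dependence of the max-mixture vector\<close>

text \<open>The coefficient in component \<open>i\<close> of each variable of the joint family, with
  \<open>Inl\<close> for the \<open>Y\<close> and \<open>Inr\<close> for the \<open>Z\<close>
  variables. Padding with zeros lets all components share one index set, so that their weights can
  be combined index by index.\<close>

definition mixture_weight :: "nat \<Rightarrow> (nat \<Rightarrow> nat \<Rightarrow> real) \<Rightarrow> real \<Rightarrow> nat \<Rightarrow> nat + nat \<Rightarrow> real" where
  "mixture_weight D \<alpha> C i =
    case_sum (\<lambda>m. if m = i then C - (\<Sum>j=1..D. \<alpha> i j) else 0) (\<alpha> i)"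

lemma sum_mixture_weight:
  assumes "i \<in> {1..d}"
  shows "(\<Sum>n\<in>{1..d} <+> {1..D}. mixture_weight D \<alpha> C i n) = C"
proof -
  have "(\<Sum>n\<in>{1..d} <+> {1..D}. mixture_weight D \<alpha> C i n) =
    (\<Sum>m=1..d. if m = i then C - (\<Sum>j=1..D. \<alpha> i j) else 0) + (\<Sum>j=1..D. \<alpha> i j)"
    by (simp add: mixture_weight_def sum.Plus)
  then show ?thesis using assms by (simp add: sum.delta)
qed

text \<open>No \<open>Y\<close> variable is shared by two components: at each \<open>Inl\<close>
  index one of the weights is 0 and the other, by the row bounds, is nonnegative.\<close>

lemma sum_min_mixture_weight:
  assumes "s \<noteq> k" "(\<Sum>j=1..D. \<alpha> s j) \<le> C" "(\<Sum>j=1..D. \<alpha> k j) \<le> C"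
  shows "(\<Sum>n\<in>{1..d} <+> {1..D}. min (mixture_weight D \<alpha> C s n) (mixture_weight D \<alpha> C k n))
    = (\<Sum>j=1..D. min (\<alpha> s j) (\<alpha> k j))"
proof -
  have "min (mixture_weight D \<alpha> C s (Inl m)) (mixture_weight D \<alpha> C k (Inl m)) = 0" for m
    using assms by (auto simp: mixture_weight_def)
  then show ?thesis by (simp add: sum.Plus mixture_weight_def)
qed

lemma max_mixture_vector_tail_dependence:
  assumes mix: "max_mixture_vector M d D \<alpha> C X"
    and "1 \<le> D" "0 < C" and nonneg: "\<And>i j. i \<in> {1..d} \<Longrightarrow> j \<in> {1..D} \<Longrightarrow> 0 \<le> \<alpha> i j"
    and row: "\<And>i. i \<in> {1..d} \<Longrightarrow> (\<Sum>j=1..D. \<alpha> i j) \<le> C"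
    and sk: "s \<in> {1..d}" "k \<in> {1..d}" "s \<noteq> k"
  shows "has_tail_dependence_coeff M X s k (1 / C * (\<Sum>j=1..D. min (\<alpha> s j) (\<alpha> k j)))"
proof -
  interpret prob_space M using mix by (simp add: max_mixture_vector_def)
  obtain Y Z where Y: "\<And>i. i \<in> {1..d} \<Longrightarrow> unit_frechet M (Y i)"
    and Z: "\<And>j. j \<in> {1..D} \<Longrightarrow> unit_frechet M (Z j)"
    and ind: "indep_vars (\<lambda>_. borel) (case_sum Y Z) ({1..d} <+> {1..D})"
    and X: "\<And>i \<omega>. i \<in> {1..d} \<Longrightarrow> \<omega> \<in> space M \<Longrightarrow>
      X i \<omega> = max (MAX j\<in>{1..D}. \<alpha> i j * Z j \<omega>) ((C - (\<Sum>j=1..D. \<alpha> i j)) * Y i \<omega>)"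
    using mix unfolding max_mixture_vector_def by blast
  define I where "I = ({1..d} <+> {1..D} :: (nat + nat) set)"
  define V where "V = case_sum Y Z"
  define b where "b = mixture_weight D \<alpha> C"
  have I: "finite I" "I \<noteq> {}" using \<open>1 \<le> D\<close> by (auto simp: I_def)
  have V: "unit_frechet M (V n)" if "n \<in> I" for n using that Y Z by (auto simp: I_def V_def)
  have b: "0 \<le> b i n" if "i \<in> {1..d}" "n \<in> I" for i n
    using that nonneg row by (auto simp: I_def b_def mixture_weight_def)
  have V_prob: "\<P>(\<omega> in M. \<forall>n\<in>I. c n * V n \<omega> \<le> x) = exp (- (\<Sum>n\<in>I. c n) / x)"
    if "\<And>n. n \<in> I \<Longrightarrow> 0 \<le> c n" "0 < x" for c x
    using ind I V that by (intro indep_unit_frechet_prob_scaled_le) (auto simp: I_def V_def)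
  \<comment> \<open>Positivity of \<open>x\<close> makes the constraints at the padded indices,
    where the weight is 0, hold automatically.\<close>
  have X_le: "X i \<omega> \<le> x \<longleftrightarrow> (\<forall>n\<in>I. b i n * V n \<omega> \<le> x)"
    if "i \<in> {1..d}" "0 < x" "\<omega> \<in> space M" for i \<omega> x
  proof -
    have "X i \<omega> \<le> x \<longleftrightarrow>
      (\<forall>j\<in>{1..D}. \<alpha> i j * Z j \<omega> \<le> x) \<and> (C - (\<Sum>j=1..D. \<alpha> i j)) * Y i \<omega> \<le> x"
      using \<open>1 \<le> D\<close> by (simp add: X[OF that(1,3)])
    also have "\<dots> \<longleftrightarrow> (\<forall>n\<in>I. b i n * V n \<omega> \<le> x)"
    proof
      assume "\<forall>n\<in>I. b i n * V n \<omega> \<le> x"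
      then have "\<forall>j\<in>{1..D}. b i (Inr j) * V (Inr j) \<omega> \<le> x" "b i (Inl i) * V (Inl i) \<omega> \<le> x"
        using that(1) unfolding I_def by blast+
      then show "(\<forall>j\<in>{1..D}. \<alpha> i j * Z j \<omega> \<le> x) \<and> (C - (\<Sum>j=1..D. \<alpha> i j)) * Y i \<omega> \<le> x"
        by (simp add: V_def b_def mixture_weight_def)
    qed (use that(2) in \<open>auto simp: I_def V_def b_def mixture_weight_def\<close>)
    finally show ?thesis .
  qed
  have meas: "X i \<in> borel_measurable M" if "i \<in> {1..d}" for i
  proof -
    have "Y i \<in> borel_measurable M" "\<And>j. j \<in> {1..D} \<Longrightarrow> Z j \<in> borel_measurable M"
      using Y Z that by (auto simp: unit_frechet_def)
    then show ?thesis
      \<comment> \<open>The formula determines \<open>X i\<close> only on \<open>space M\<close>,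
        hence the passage through congruence.\<close>
      by (subst measurable_cong[OF X[OF that]])
        (auto intro!: borel_measurable_max borel_measurable_Max borel_measurable_times)
  qed
  have sum_b: "(\<Sum>n\<in>I. b i n) = C" if "i \<in> {1..d}" for i
    unfolding I_def b_def by (rule sum_mixture_weight[OF that])
  have marg: "\<P>(\<omega> in M. X i \<omega> \<le> x) = exp (- C / x)" if "i \<in> {1..d}" "0 < x" for i x
  proof -
    have "{\<omega> \<in> space M. X i \<omega> \<le> x} = {\<omega> \<in> space M. \<forall>n\<in>I. b i n * V n \<omega> \<le> x}"
      using X_le[OF that] by auto
    then show ?thesis
      using V_prob[of "b i" x] b that sum_b by simp
  qed
  define L where "L = (\<Sum>j=1..D. min (\<alpha> s j) (\<alpha> k j))"
  have joint: "\<P>(\<omega> in M. X s \<omega> \<le> x \<and> X k \<omega> \<le> x) = exp (- (2 * C - L) / x)" if "0 < x" for x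
  proof -
    \<comment> \<open>Frechet variables are positive only almost surely, so negative
      \<open>v\<close> must be treated too: any nonnegative multiple of it is below
      \<open>x\<close>, and both sides hold.\<close>
    have "b s n * v \<le> x \<and> b k n * v \<le> x \<longleftrightarrow> max (b s n) (b k n) * v \<le> x" if "n \<in> I" for n v
    proof (cases "0 \<le> v")
      case True
      then show ?thesis by (simp add: max_mult_distrib_right)
    next
      case False
      then have "c * v \<le> x" if "0 \<le> c" for c
        using mult_nonneg_nonpos[of c v] that \<open>0 < x\<close> by linarith
      then show ?thesis using b[OF sk(1) that] b[OF sk(2) that] by (simp add: le_max_iff_disj)
    qed
    then have "{\<omega> \<in> space M. X s \<omega> \<le> x \<and> X k \<omega> \<le> x}
        = {\<omega> \<in> space M. \<forall>n\<in>I. max (b s n) (b k n) * V n \<omega> \<le> x}"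
      using X_le[OF sk(1) that] X_le[OF sk(2) that] by blast
    moreover have "(\<Sum>n\<in>I. max (b s n) (b k n)) = 2 * C - L"
    proof -
      have "max (b s n) (b k n) = b s n + b k n - min (b s n) (b k n)" for n by simp
      then have "(\<Sum>n\<in>I. max (b s n) (b k n))
          = (\<Sum>n\<in>I. b s n) + (\<Sum>n\<in>I. b k n) - (\<Sum>n\<in>I. min (b s n) (b k n))"
        by (simp only: sum.distrib sum_subtractf)
      then show ?thesis
        using sum_min_mixture_weight[OF sk(3) row[OF sk(1)] row[OF sk(2)], where d = d]
        by (simp add: I_def[symmetric] b_def[symmetric] L_def sum_b[OF sk(1)] sum_b[OF sk(2)]
            del: One_nat_def)
    qed
    ultimately show ?thesis
      using V_prob[of "\<lambda>n. max (b s n) (b k n)" x] b[OF sk(1)] that by (simp add: le_max_iff_disj)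
  qed
  have "has_tail_dependence_coeff M X s k (2 - (2 * C - L) / C)"
    using meas marg joint sk \<open>0 < C\<close> by (intro has_tail_dependence_coeff_frechet) auto
  moreover have "2 - (2 * C - L) / C = 1 / C * L" using \<open>0 < C\<close> by (simp add: field_simps)
  ultimately show ?thesis by (simp add: L_def)
qed

section \<open>Range of tail dependence coefficients\<close>

lemma (in prob_space) has_tail_dependence_coeff_bounds:
  assumes [measurable]: "W k \<in> borel_measurable M" and "has_tail_dependence_coeff M W s k l"
  shows "0 \<le> l" "l \<le> 1"
proof -
  interpret D: real_distribution "distr M borel (W k)"
    by (rule real_distribution_distr) simp
  \<comment> \<open>This makes the conditioning event measurable, as monotonicity of the measure
    requires of the larger set.\<close>
  have [measurable]: "cdf (distr M borel (W k)) \<in> borel_measurable borel"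
    by (intro borel_measurable_mono monoI D.cdf_nondecreasing)
  have "0 \<le> cond_prob M P (\<lambda>\<omega>. cdf (distr M borel (W k)) (W k \<omega>) > u)"
    "cond_prob M P (\<lambda>\<omega>. cdf (distr M borel (W k)) (W k \<omega>) > u) \<le> 1" for P u
    by (auto simp: cond_prob_def intro!: divide_le_eq_1[THEN iffD2] finite_measure_mono
        simp: zero_less_measure_iff)
  then show "0 \<le> l" "l \<le> 1"
    using assms(2) unfolding has_tail_dependence_coeff_def
    by (auto intro: tendsto_lowerbound tendsto_upperbound)
qed

section \<open>Existence of max-mixture vectors\<close>

lemma exists_frechet_distribution:
  obtains \<mu> :: "real measure"
  where "prob_space \<mu>" "sets \<mu> = sets borel" "\<And>x. cdf \<mu> x = (if 0 < x then exp (- 1 / x) else 0)"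
proof -
  define F where "F = (\<lambda>x::real. if 0 < x then exp (- 1 / x) else 0)"
  have mono: "F x \<le> F y" if "x \<le> y" for x y
    using that by (auto simp: F_def field_simps)
  have right: "continuous (at_right a) F" for a
  proof (cases "0 < a")
    case True
    then have "\<forall>\<^sub>F x in at_right a. exp (- 1 / x) = F x"
      by (auto simp: eventually_at_right_field F_def intro!: exI[of _ "a + 1"])
    moreover have "((\<lambda>x. exp (- 1 / x)) \<longlongrightarrow> exp (- 1 / a)) (at_right a)"
      using True by (auto intro!: tendsto_intros)
    ultimately show ?thesis
      using True by (auto simp: continuous_within F_def[THEN fun_cong, of a] intro: Lim_transform_eventually)
  next
    case False
    show ?thesis
    proof (cases "a = 0")
      case True
      \<comment> \<open>The two branches of \<open>F\<close> meet at 0, where right continuity rests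
        on this limit.\<close>
      have "((\<lambda>x::real. exp (- 1 / x)) \<longlongrightarrow> 0) (at_right 0)" by real_asymp
      moreover have "\<forall>\<^sub>F x in at_right 0. exp (- 1 / x) = F x"
        by (auto simp: eventually_at_right_field F_def intro!: exI[of _ 1])
      ultimately show ?thesis
        using True by (auto simp: continuous_within F_def[THEN fun_cong, of 0] intro: Lim_transform_eventually)
    next
      case False
      then have "a < 0" using \<open>\<not> 0 < a\<close> by simp
      then have "\<forall>\<^sub>F x in at_right a. 0 = F x"
        by (auto simp: eventually_at_right_field F_def intro!: exI[of _ 0])
      then show ?thesis
        using \<open>a < 0\<close>
        by (auto simp: continuous_within F_def[THEN fun_cong, of a] intro: Lim_transform_eventually[OF tendsto_const])
    qed
  qed
  have bot: "(F \<longlongrightarrow> 0) at_bot"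
    by (rule Lim_transform_eventually[OF tendsto_const])
      (auto simp: eventually_at_bot_linorder F_def intro!: exI[of _ 0])
  have top: "(F \<longlongrightarrow> 1) at_top"
  proof (rule Lim_transform_eventually)
    show "((\<lambda>x::real. exp (- 1 / x)) \<longlongrightarrow> 1) at_top" by real_asymp
    show "\<forall>\<^sub>F x in at_top. exp (- 1 / x) = F x"
      by (auto simp: eventually_at_top_linorder F_def intro!: exI[of _ 1])
  qed
  interpret real_distribution "interval_measure F"
    by (rule real_distribution_interval_measure[OF mono right bot top])
  show ?thesis
    using that[of "interval_measure F"] prob_space_axioms measure_interval_measure_Iic[OF mono right bot]
    by (simp add: cdf_def2 F_def)
qed

text \<open>A claim about all vectors satisfying the predicate could hold vacuously; this rules that
  out. The canonical model is a product of copies of the unit Frechet law, with the coordinates as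
  variables.\<close>

lemma exists_max_mixture_vector:
  assumes "1 \<le> D"
  shows "\<exists>(N :: (nat + nat \<Rightarrow> real) measure) X. max_mixture_vector N d D \<alpha> C X"
proof -
  obtain \<mu> :: "real measure" where \<mu>: "prob_space \<mu>" and sets: "sets \<mu> = sets borel"
    and cdf: "\<And>x. cdf \<mu> x = (if 0 < x then exp (- 1 / x) else 0)"
    using exists_frechet_distribution by blast
  define I where "I = ({1..d} <+> {1..D} :: (nat + nat) set)"
  define N where "N = PiM I (\<lambda>_. \<mu>)"
  interpret prob_space N unfolding N_def by (rule prob_space_PiM) (rule \<mu>)
  have comp: "(\<lambda>\<omega>. \<omega> n) \<in> borel_measurable N" if "n \<in> I" for n
    using measurable_component_singleton[OF that, of "\<lambda>_. \<mu>"] measurable_cong_sets[OF refl sets]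
    by (auto simp: N_def)
  have distr: "distr N borel (\<lambda>\<omega>. \<omega> n) = \<mu>" if "n \<in> I" for n
  proof -
    have "distr N borel (\<lambda>\<omega>. \<omega> n) = distr N \<mu> (\<lambda>\<omega>. \<omega> n)"
      by (rule distr_cong) (simp_all add: sets)
    then show ?thesis using distr_PiM_component[of I "\<lambda>_. \<mu>" n] \<mu> that by (simp add: N_def)
  qed
  have frechet: "unit_frechet N (\<lambda>\<omega>. \<omega> n)" if "n \<in> I" for n
    using comp distr cdf that by (simp add: unit_frechet_def)
  have "indep_vars (\<lambda>_. borel) (\<lambda>n \<omega>. \<omega> n) I"
  \<comment> \<open>Independence means that the joint law is the product of the marginals. The joint
    law of the coordinates is \<open>N\<close> itself, because points of a product space are
    extensional and restriction to \<open>I\<close> fixes them.\<close>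
  proof (subst indep_vars_iff_distr_eq_PiM')
    show "I \<noteq> {}" using assms by (auto simp: I_def)
    have "distr N (Pi\<^sub>M I (\<lambda>_. borel)) (\<lambda>x. \<lambda>i\<in>I. x i) = distr N N (\<lambda>x. x)"
    proof (rule distr_cong)
      show "sets (Pi\<^sub>M I (\<lambda>_. borel)) = sets N"
        unfolding N_def by (rule sets_PiM_cong) (simp_all add: sets)
      show "(\<lambda>i\<in>I. x i) = x" if "x \<in> space N" for x
        using that by (simp add: N_def space_PiM PiE_restrict)
    qed simp
    also have "\<dots> = N" by (rule distr_id)
    also have "\<dots> = (\<Pi>\<^sub>M i\<in>I. distr N borel (\<lambda>\<omega>. \<omega> i))"
      by (subst N_def, rule PiM_cong) (simp_all add: distr)
    finally show "distr N (Pi\<^sub>M I (\<lambda>_. borel)) (\<lambda>x. \<lambda>i\<in>I. x i) = (\<Pi>\<^sub>M i\<in>I. distr N borel (\<lambda>\<omega>. \<omega> i))" .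
  qed (use comp in simp)
  moreover have "case_sum (\<lambda>i \<omega>. \<omega> (Inl i)) (\<lambda>j \<omega>. \<omega> (Inr j) :: real)
      = (\<lambda>(n :: nat + nat) \<omega>. \<omega> n)"
    by (auto simp: fun_eq_iff split: sum.split)
  ultimately have "indep_vars (\<lambda>_. borel) (case_sum (\<lambda>i \<omega>. \<omega> (Inl i)) (\<lambda>j \<omega>. \<omega> (Inr j))) ({1..d} <+> {1..D})"
    by (simp only: I_def)
  then have "max_mixture_vector N d D \<alpha> C (\<lambda>i \<omega>. max (MAX j\<in>{1..D}. \<alpha> i j * \<omega> (Inr j))
      ((C - (\<Sum>j=1..D. \<alpha> i j)) * \<omega> (Inl i)))"
    unfolding max_mixture_vector_def using frechet prob_space_axioms
    by (intro conjI exI[of _ "\<lambda>i \<omega>. \<omega> (Inl i)"] exI[of _ "\<lambda>j \<omega>. \<omega> (Inr j)"]) (auto simp: I_def)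
  then show ?thesis by blast
qed

section \<open>Weights realising prescribed coefficients\<close>

text \<open>Two distinct components have exactly one pair in common, so the sum of minima isolates
  its coefficient. A component lies in \<open>d - 1\<close> pairs, each of weight at most 1.\<close>

lemma exists_pair_weights:
  fixes l :: "nat \<Rightarrow> nat \<Rightarrow> real"
  assumes "2 \<le> d"
    and l: "\<And>s k. s \<in> {1..d} \<Longrightarrow> k \<in> {1..d} \<Longrightarrow> s \<noteq> k \<Longrightarrow> 0 \<le> l s k \<and> l s k \<le> 1 \<and> l s k = l k s"
  obtains D :: nat and \<alpha> :: "nat \<Rightarrow> nat \<Rightarrow> real"
  where "1 \<le> D" "\<And>i j. i \<in> {1..d} \<Longrightarrow> j \<in> {1..D} \<Longrightarrow> 0 \<le> \<alpha> i j"
    "\<And>i. i \<in> {1..d} \<Longrightarrow> (\<Sum>j=1..D. \<alpha> i j) \<le> real d - 1"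
    "\<And>s k. s \<in> {1..d} \<Longrightarrow> k \<in> {1..d} \<Longrightarrow> s \<noteq> k \<Longrightarrow> (\<Sum>j=1..D. min (\<alpha> s j) (\<alpha> k j)) = l s k"
proof -
  define P where "P = {(s, k). s \<in> {1..d} \<and> k \<in> {1..d} \<and> s < k}"
  define w where "w = (\<lambda>i (s, k). if i = s \<or> i = k then l s k else 0)"
  have "P \<subseteq> {1..d} \<times> {1..d}" by (auto simp: P_def)
  then have "finite P" by (rule finite_subset) simp
  have "(1, 2) \<in> P" using assms(1) by (auto simp: P_def)
  then have "1 \<le> card P" using \<open>finite P\<close> by (metis One_nat_def Suc_leI card_gt_0_iff empty_iff)
  \<comment> \<open>The pairs are numbered from 1 to serve as the index \<open>j\<close>, so
    \<open>D\<close> is \<open>card P\<close>.\<close>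
  obtain f where f: "bij_betw f {1..card P} P"
    using ex_bij_betw_nat_finite_1[OF \<open>finite P\<close>] by blast
  have w: "0 \<le> w i p" "w i p \<le> 1" if "p \<in> P" for i p
    using that l by (auto simp: P_def w_def)
  show ?thesis
  proof (rule that[of "card P" "\<lambda>i j. w i (f j)"])
    show "0 \<le> w i (f j)" if "j \<in> {1..card P}" for i j
      using w bij_betwE[OF f] that by blast
    show "(\<Sum>j=1..card P. w i (f j)) \<le> real d - 1" if i: "i \<in> {1..d}" for i
    proof -
      \<comment> \<open>The pairs that contain \<open>i\<close>, listed by the other member
        \<open>m\<close>; \<open>min\<close> and \<open>max\<close> put each in increasing
        order.\<close>
      let ?Q = "(\<lambda>m. (min i m, max i m)) ` ({1..d} - {i})"
      have "?Q \<subseteq> P" using i by (auto simp: P_def min_def max_def)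
      have "w i p = 0" if "p \<in> P - ?Q" for p
      proof (rule ccontr)
        assume "w i p \<noteq> 0"
        then have "fst p = i \<or> snd p = i" by (auto simp: w_def split: prod.splits if_splits)
        then have "p = (min i (snd p), max i (snd p)) \<and> snd p \<noteq> i \<or> p = (min i (fst p), max i (fst p)) \<and> fst p \<noteq> i"
          using that by (auto simp: P_def)
        moreover have "fst p \<in> {1..d}" "snd p \<in> {1..d}" using that by (auto simp: P_def)
        ultimately show False using that by blast
      qed
      then have "(\<Sum>p\<in>P. w i p) = (\<Sum>p\<in>?Q. w i p)"
        using \<open>finite P\<close> \<open>?Q \<subseteq> P\<close> by (intro sum.mono_neutral_right) auto
      also have "\<dots> \<le> real (card ?Q) * 1"
        using w \<open>?Q \<subseteq> P\<close> by (intro sum_bounded_above) blast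
      also have "\<dots> \<le> real (card ({1..d} - {i}))" using card_image_le[of "{1..d} - {i}"] by simp
      also have "\<dots> = real d - 1" using i by (simp add: of_nat_diff)
      finally show ?thesis using sum.reindex_bij_betw[OF f, of "w i"] by simp
    qed
    show "(\<Sum>j=1..card P. min (w s (f j)) (w k (f j))) = l s k"
      if sk: "s \<in> {1..d}" "k \<in> {1..d}" "s \<noteq> k" for s k
    proof -
      let ?p = "(min s k, max s k)"
      have "?p \<in> P" using sk by (auto simp: P_def min_def max_def)
      have "(\<Sum>p\<in>P. min (w s p) (w k p)) = (\<Sum>p\<in>{?p}. min (w s p) (w k p))"
      proof (rule sum.mono_neutral_right)
        show "\<forall>p\<in>P - {?p}. min (w s p) (w k p) = 0"
        proof
          fix p assume p: "p \<in> P - {?p}"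
          obtain a b where ab: "p = (a, b)" by (cases p)
          \<comment> \<open>Any other pair misses \<open>s\<close> or \<open>k\<close>, so one
            weight is 0; the minimum is 0 only because the other is nonnegative.\<close>
          have "0 \<le> l a b" using p l ab by (auto simp: P_def)
          moreover have "\<not> ((s = a \<or> s = b) \<and> (k = a \<or> k = b))"
            using p ab sk by (auto simp: P_def min_def max_def split: if_splits)
          ultimately show "min (w s p) (w k p) = 0" by (auto simp: w_def ab)
        qed
      qed (use \<open>finite P\<close> \<open>?p \<in> P\<close> in auto)
      \<comment> \<open>For \<open>k < s\<close> the stored weight is \<open>l k s\<close>, and the
        symmetry of \<open>l\<close> is used.\<close>
      also have "\<dots> = l s k" using l[OF sk] by (auto simp: w_def min_def max_def)
      finally show ?thesis
        using sum.reindex_bij_betw[OF f, of "\<lambda>p. min (w s p) (w k p)"] by simp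
    qed
  qed (use \<open>1 \<le> card P\<close> in auto)
qed

theorem proposition2p2:
  fixes d :: nat
  assumes "d \<ge> 2"
  shows
    "(\<forall>(D::nat) (\<alpha> :: nat \<Rightarrow> nat \<Rightarrow> real) (C::real) (M :: 'a measure) X.
        D \<ge> 1 \<longrightarrow>
        (\<forall>i\<in>{1..d}. \<forall>j\<in>{1..D}. \<alpha> i j \<ge> 0) \<longrightarrow>
        C > 0 \<longrightarrow>
        C \<ge> (MAX i\<in>{1..d}. \<Sum>j=1..D. \<alpha> i j) \<longrightarrow>
        max_mixture_vector M d D \<alpha> C X \<longrightarrow>
        (\<forall>s\<in>{1..d}. \<forall>k\<in>{1..d}. s \<noteq> k \<longrightarrow>
           has_tail_dependence_coeff M X s k (1 / C * (\<Sum>j=1..D. min (\<alpha> s j) (\<alpha> k j))))) \<and>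
     (\<forall>(\<Omega> :: 'b measure) (W :: nat \<Rightarrow> 'b \<Rightarrow> real) (l :: nat \<Rightarrow> nat \<Rightarrow> real) (C::real).
        prob_space \<Omega> \<longrightarrow>
        (\<forall>i\<in>{1..d}. W i \<in> borel_measurable \<Omega>) \<longrightarrow>
        (\<forall>s\<in>{1..d}. \<forall>k\<in>{1..d}. s \<noteq> k \<longrightarrow> has_tail_dependence_coeff \<Omega> W s k (l s k)) \<longrightarrow>
        (\<forall>s\<in>{1..d}. \<forall>k\<in>{1..d}. s \<noteq> k \<longrightarrow> l s k = l k s) \<longrightarrow>
        C \<ge> real d - 1 \<longrightarrow>
        (\<exists>(D::nat) (\<alpha> :: nat \<Rightarrow> nat \<Rightarrow> real).
           D \<ge> 1 \<and>
           (\<forall>i\<in>{1..d}. \<forall>j\<in>{1..D}. \<alpha> i j \<ge> 0) \<and>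
           (MAX i\<in>{1..d}. \<Sum>j=1..D. \<alpha> i j) \<le> C \<and>
           (\<exists>(N :: (nat + nat \<Rightarrow> real) measure) X. max_mixture_vector N d D \<alpha> C X) \<and>
           (\<forall>(M :: 'c measure) X. max_mixture_vector M d D \<alpha> C X \<longrightarrow>
              (\<forall>s\<in>{1..d}. \<forall>k\<in>{1..d}. s \<noteq> k \<longrightarrow>
                 has_tail_dependence_coeff M X s k (1 / C * l s k)))))"
proof (intro conjI allI impI ballI)
  fix D \<alpha> C X s k and M :: "'a measure"
  assume "D \<ge> 1" "\<forall>i\<in>{1..d}. \<forall>j\<in>{1..D}. \<alpha> i j \<ge> 0" "C > 0"
    and row: "(MAX i\<in>{1..d}. \<Sum>j=1..D. \<alpha> i j) \<le> C"
    and "max_mixture_vector M d D \<alpha> C X" "s \<in> {1..d}" "k \<in> {1..d}" "s \<noteq> k"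
  moreover have "(\<Sum>j=1..D. \<alpha> i j) \<le> C" if "i \<in> {1..d}" for i
    using row that by (subst (asm) Max_le_iff) auto
  ultimately show "has_tail_dependence_coeff M X s k (1 / C * (\<Sum>j=1..D. min (\<alpha> s j) (\<alpha> k j)))"
    by (intro max_mixture_vector_tail_dependence) auto
next
  fix \<Omega> :: "'b measure" and W l and C :: real
  assume "prob_space \<Omega>" and W: "\<forall>i\<in>{1..d}. W i \<in> borel_measurable \<Omega>"
    and coeff: "\<forall>s\<in>{1..d}. \<forall>k\<in>{1..d}. s \<noteq> k \<longrightarrow> has_tail_dependence_coeff \<Omega> W s k (l s k)"
    and sym: "\<forall>s\<in>{1..d}. \<forall>k\<in>{1..d}. s \<noteq> k \<longrightarrow> l s k = l k s"
    and C: "C \<ge> real d - 1"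
  interpret prob_space \<Omega> by fact
  \<comment> \<open>What the construction takes from \<open>W\<close>: coefficients in the unit
    interval that are symmetric.\<close>
  have l: "0 \<le> l s k \<and> l s k \<le> 1 \<and> l s k = l k s" if "s \<in> {1..d}" "k \<in> {1..d}" "s \<noteq> k" for s k
    using has_tail_dependence_coeff_bounds[of W k s "l s k"] W coeff sym that by blast
  obtain D :: nat and \<alpha> where D: "1 \<le> D" and \<alpha>: "\<And>i j. i \<in> {1..d} \<Longrightarrow> j \<in> {1..D} \<Longrightarrow> 0 \<le> \<alpha> i j"
    and row: "\<And>i. i \<in> {1..d} \<Longrightarrow> (\<Sum>j=1..D. \<alpha> i j) \<le> real d - 1"
    and min: "\<And>s k. s \<in> {1..d} \<Longrightarrow> k \<in> {1..d} \<Longrightarrow> s \<noteq> k \<Longrightarrow>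
      (\<Sum>j=1..D. min (\<alpha> s j) (\<alpha> k j)) = l s k"
  proof (rule exists_pair_weights[OF assms, of l], goal_cases)
    case (1 s k)
    then show ?case using l by blast
  next
    case (2 D \<alpha>)
    show ?case by (rule 2(1)) (fact 2)+
  qed
  have row_C: "(\<Sum>j=1..D. \<alpha> i j) \<le> C" if "i \<in> {1..d}" for i
    using row[OF that] C by linarith
  \<comment> \<open>The weights are the unscaled \<open>l s k\<close>; the factor
    \<open>1 / C\<close> comes from the formula of part (a). Its premise \<open>0 < C\<close>
    follows from \<open>C \<ge> real d - 1\<close> and \<open>d \<ge> 2\<close>.\<close>
  have tail: "has_tail_dependence_coeff M X s k (1 / C * l s k)"
    if "max_mixture_vector M d D \<alpha> C X" "s \<in> {1..d}" "k \<in> {1..d}" "s \<noteq> k" for M :: "'c measure" and X s k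
    using max_mixture_vector_tail_dependence[OF that(1) D _ \<alpha> row_C that(2-4)] min[OF that(2-4)] assms C
    by simp
  have "(MAX i\<in>{1..d}. \<Sum>j=1..D. \<alpha> i j) \<le> C"
    using row_C assms by (subst Max_le_iff) auto
  then show "\<exists>D \<alpha>. D \<ge> 1 \<and> (\<forall>i\<in>{1..d}. \<forall>j\<in>{1..D}. \<alpha> i j \<ge> 0) \<and>
      (MAX i\<in>{1..d}. \<Sum>j=1..D. \<alpha> i j) \<le> C \<and>
      (\<exists>(N :: (nat + nat \<Rightarrow> real) measure) X. max_mixture_vector N d D \<alpha> C X) \<and>
      (\<forall>(M :: 'c measure) X. max_mixture_vector M d D \<alpha> C X \<longrightarrow>
        (\<forall>s\<in>{1..d}. \<forall>k\<in>{1..d}. s \<noteq> k \<longrightarrow> has_tail_dependence_coeff M X s k (1 / C * l s k)))"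
    using D \<alpha> tail exists_max_mixture_vector[OF D] by (intro exI[of _ D] exI[of _ \<alpha>]) blast
qed

end
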